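(* Let $\mathcal H$ be an infinite-dimensional Hilbert space, let $k\ge 1$, and let $F\colon\mathcal D^k\to B(\mathcal H)_{\mathrm{sa}}$ be a convex regular mapping of the set $\mathcal D^k$ of $k$-tuples of positive semi-definite operators on $\mathcal H$ into the self-adjoint operators on $\mathcal H$. (i) Let $C$ be a contraction on $\mathcal H$. If $F(0,\dots,0)\le 0$, then \[ F(C^*A_1C,\dots,C^*A_kC)\le C^*F(A_1,\dots,A_k)C \] for all $(A_1,\dots,A_k)\in\mathcal D^k$. (ii) Let $X$ and $Y$ be bounded operators on $\mathcal H$ with $X^*X+Y^*Y=1$. Then \[ F\bigl(X^*A_1X+Y^*B_1Y,\dots,X^*A_kX+Y^*B_kY\bigr)\le X^*F(A_1,\dots,A_k)X+Y^*F(B_1,\dots,B_k)Y \] for all $(A_1,\dots,A_k)$ and $(B_1,\dots,B_k)$ in $\mathcal D^k$.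
   Context: $B(\mathcal K)$ denotes the bounded linear operators on a Hilbert space $\mathcal K$; inequalities between self-adjoint operators refer to the usual operator (Loewner) order. For a nonzero closed subspace $\mathcal K\subseteq\mathcal H$ let $\mathcal D^k(\mathcal K)=\{(A_1,\dots,A_k)\mid A_i\in B(\mathcal K),\ A_i\ge 0\}$, and write $\mathcal D^k=\mathcal D^k(\mathcal H)$. A map $F$ on $\mathcal D^k$ is convex if $F(\lambda A+(1-\lambda)B)\le\lambda F(A)+(1-\lambda)F(B)$ for all $k$-tuples $A,B\in\mathcal D^k$ and $\lambda\in[0,1]$ (joint convexity). Regular mappings. A map $F\colon\mathcal D^k\to B(\mathcal H)$ is called regular if there are maps $F_{\mathcal K}\colon\mathcal D^k(\mathcal K)\to B(\mathcal K)$, one for each nonzero closed subspace $\mathcal K\subseteq\mathcal H$, with $F_{\mathcal H}=F$, such that: (1) (unitary invariance) $F_{\mathcal L}(ux_1u^*,\dots,ux_ku^* )=uF_{\mathcal K}(x_1,\dots,x_k)u^*$ for every unitary $u\colon\mathcal K\to\mathcal L$ between nonzero closed subspaces $\mathcal K,\mathcal L$ of $\mathcal H$ and every $(x_1,\dots,x_k)\in\mathcal D^k(\mathcal K)$; (2) (block diagonal rule) $F_{\mathcal K\oplus\mathcal L}(x_1\oplus y_1,\dots,x_k\oplus y_k)=F_{\mathcal K}(x_1,\dots,x_k)\oplus F_{\mathcal L}(y_1,\dots,y_k)$ for mutually orthogonal nonzero closed subspaces $\mathcal K,\mathcal L$ of $\mathcal H$, $(x_i)\in\mathcal D^k(\mathcal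 K)$ and $(y_i)\in\mathcal D^k(\mathcal L)$. In particular, $F$ extends consistently to tuples of operators on $\mathcal H\oplus\mathcal H\cong\mathcal H$ with $F(x\oplus y)=F(x)\oplus F(y)$. *)

theory Defs
  imports "HOL-Analysis.Analysis"
begin

text \<open>
  Complex Hilbert spaces, as a refinement of the library's complete real inner product spaces:
  the real inner product (hence norm and topology) is the one induced by the complex inner
  product, which is antilinear in the first argument.  Positive definiteness is inherited from
  \<^class>\<open>real_inner\<close>.
\<close>

class complex_hilbert = real_inner + complete_space +
  fixes scaleC :: "complex \<Rightarrow> 'a \<Rightarrow> 'a"  (infixr "*\<^sub>C" 75)
    and cinner :: "'a \<Rightarrow> 'a \<Rightarrow> complex"
  assumes scaleC_add_right: "a *\<^sub>C (x + y) = a *\<^sub>C x + a *\<^sub>C y"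
    and scaleC_add_left: "(a + b) *\<^sub>C x = a *\<^sub>C x + b *\<^sub>C x"
    and scaleC_scaleC: "a *\<^sub>C b *\<^sub>C x = (a * b) *\<^sub>C x"
    and scaleC_one: "1 *\<^sub>C x = x"
    and scaleR_scaleC: "r *\<^sub>R x = complex_of_real r *\<^sub>C x"
    and cinner_commute: "cinner x y = cnj (cinner y x)"
    and cinner_add_right: "cinner x (y + z) = cinner x y + cinner x z"
    and cinner_scaleC_right: "cinner x (a *\<^sub>C y) = a * cinner x y"
    and inner_eq_Re_cinner: "x \<bullet> y = Re (cinner x y)"

global_interpretation complex_vector:
  vector_space "scaleC :: complex \<Rightarrow> 'a \<Rightarrow> 'a::complex_hilbert"
  by unfold_locales (simp_all add: scaleC_add_right scaleC_add_left scaleC_scaleC scaleC_one)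

definition infinite_dimensional :: "'h::complex_hilbert itself \<Rightarrow> bool" where
  "infinite_dimensional _ \<longleftrightarrow> \<not> (\<exists>B :: 'h set. finite B \<and> complex_vector.span B = UNIV)"

definition nonzero_closed_csubspace :: "'h::complex_hilbert set \<Rightarrow> bool" where
  "nonzero_closed_csubspace K \<longleftrightarrow> complex_vector.subspace K \<and> closed K \<and> K \<noteq> {0}"

definition corthogonal :: "'h::complex_hilbert set \<Rightarrow> 'h set \<Rightarrow> bool" where
  "corthogonal K L \<longleftrightarrow> (\<forall>x\<in>K. \<forall>y\<in>L. cinner x y = 0)"

definition ocomplement :: "'h::complex_hilbert set \<Rightarrow> 'h set" where
  "ocomplement K = {y. \<forall>x\<in>K. cinner x y = 0}"

definition subspace_sum :: "'h::complex_hilbert set \<Rightarrow> 'h set \<Rightarrow> 'h set" where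
  "subspace_sum K L = {x + y | x y. x \<in> K \<and> y \<in> L}"

definition complex_linear :: "('h::complex_hilbert \<Rightarrow>\<^sub>L 'h) \<Rightarrow> bool" where
  "complex_linear T \<longleftrightarrow> (\<forall>c x. blinfun_apply T (c *\<^sub>C x) = c *\<^sub>C blinfun_apply T x)"

text \<open>
  An operator between closed subspaces \<open>K\<close> and \<open>L\<close> of the whole space is represented by its
  extension by zero on the orthogonal complement of \<open>K\<close>.  This is an isometric identification
  of \<open>B(K, L)\<close> with \<open>bops K L\<close>, compatible with composition, adjoints and the order, and the
  direct sum \<open>x \<oplus> y\<close> of operators on orthogonal subspaces becomes the sum \<open>x + y\<close>.
  For \<open>K = L = UNIV\<close> it consists of all bounded complex-linear operators.
\<close>

definition bops :: "'h::complex_hilbert set \<Rightarrow> 'h set \<Rightarrow> ('h \<Rightarrow>\<^sub>L 'h) set" where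
  "bops K L = {T. complex_linear T \<and> (\<forall>x. blinfun_apply T x \<in> L) \<and>
                  (\<forall>x\<in>ocomplement K. blinfun_apply T x = 0)}"

definition cadjoint :: "('h::complex_hilbert \<Rightarrow>\<^sub>L 'h) \<Rightarrow> ('h \<Rightarrow>\<^sub>L 'h)" where
  "cadjoint T = (THE S. \<forall>x y. cinner (blinfun_apply S x) y = cinner x (blinfun_apply T y))"

definition self_adjoint :: "('h::complex_hilbert \<Rightarrow>\<^sub>L 'h) \<Rightarrow> bool" where
  "self_adjoint T \<longleftrightarrow> complex_linear T \<and> cadjoint T = T"

definition positive_op :: "('h::complex_hilbert \<Rightarrow>\<^sub>L 'h) \<Rightarrow> bool" where
  "positive_op T \<longleftrightarrow> self_adjoint T \<and> (\<forall>x. 0 \<le> Re (cinner x (blinfun_apply T x)))"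

definition loewner_le :: "('h::complex_hilbert \<Rightarrow>\<^sub>L 'h) \<Rightarrow> ('h \<Rightarrow>\<^sub>L 'h) \<Rightarrow> bool"
    (infix "\<le>\<^sub>o\<^sub>p" 50) where
  "S \<le>\<^sub>o\<^sub>p T \<longleftrightarrow> positive_op (T - S)"

definition unitary_between ::
    "'h::complex_hilbert set \<Rightarrow> 'h set \<Rightarrow> ('h \<Rightarrow>\<^sub>L 'h) \<Rightarrow> bool" where
  "unitary_between K L u \<longleftrightarrow> u \<in> bops K L \<and> blinfun_apply u ` K = L \<and>
     (\<forall>x\<in>K. \<forall>y\<in>K. cinner (blinfun_apply u x) (blinfun_apply u y) = cinner x y)"

text \<open>
  The domain \<open>D\<^sup>k(K)\<close>; a \<open>k\<close>-tuple is a vector over an index type with \<open>k\<close> elements, so that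
  tuples are added and scaled entrywise.
\<close>

definition pos_tuples :: "'h::complex_hilbert set \<Rightarrow> (('h \<Rightarrow>\<^sub>L 'h) ^ 'k::finite) set" where
  "pos_tuples K = {A. \<forall>i. A $ i \<in> bops K K \<and> positive_op (A $ i)}"

definition convex_mapping ::
    "((('h::complex_hilbert \<Rightarrow>\<^sub>L 'h) ^ 'k::finite) \<Rightarrow> ('h \<Rightarrow>\<^sub>L 'h)) \<Rightarrow> bool" where
  "convex_mapping F \<longleftrightarrow>
     (\<forall>A\<in>pos_tuples UNIV. \<forall>B\<in>pos_tuples UNIV. \<forall>t\<in>{0..1}.
        F (t *\<^sub>R A + (1 - t) *\<^sub>R B) \<le>\<^sub>o\<^sub>p t *\<^sub>R F A + (1 - t) *\<^sub>R F B)"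

definition regular_mapping ::
    "((('h::complex_hilbert \<Rightarrow>\<^sub>L 'h) ^ 'k::finite) \<Rightarrow> ('h \<Rightarrow>\<^sub>L 'h)) \<Rightarrow> bool" where
  "regular_mapping F \<longleftrightarrow>
     (\<exists>FK :: 'h set \<Rightarrow> (('h \<Rightarrow>\<^sub>L 'h) ^ 'k) \<Rightarrow> ('h \<Rightarrow>\<^sub>L 'h).
        (\<forall>K. nonzero_closed_csubspace K \<longrightarrow> (\<forall>x\<in>pos_tuples K. FK K x \<in> bops K K)) \<and>
        (\<forall>x\<in>pos_tuples UNIV. FK UNIV x = F x) \<and>
        (\<forall>K L u x. nonzero_closed_csubspace K \<and> nonzero_closed_csubspace L \<and>
           unitary_between K L u \<and> x \<in> pos_tuples K \<longrightarrow>
           FK L (\<chi> i. u o\<^sub>L x $ i o\<^sub>L cadjoint u) = u o\<^sub>L FK K x o\<^sub>L cadjoint u) \<and>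
        (\<forall>K L x y. nonzero_closed_csubspace K \<and> nonzero_closed_csubspace L \<and>
           corthogonal K L \<and> x \<in> pos_tuples K \<and> y \<in> pos_tuples L \<longrightarrow>
           FK (subspace_sum K L) (x + y) = FK K x + FK L y))"

end

theory Submission
  imports Defs
begin

text \<open>
  The heart of the matter is the compression inequality
  \<open>F (W\<^sup>* T W) \<le> W\<^sup>* F(T) W\<close> for an isometry \<open>W\<close> (\<open>F_isometric_compression\<close>).  Let \<open>P = W W\<^sup>*\<close>
  be the projection onto the range of \<open>W\<close>, let \<open>Q = 1 - P\<close>, and let \<open>S = P - Q\<close>, a self-adjoint
  unitary.  The pinching \<open>P T P + Q T Q\<close> equals \<open>(T + S T S) / 2\<close>, so convexity and unitary
  invariance bound its image under \<open>F\<close> by \<open>(F(T) + S F(T) S) / 2\<close>, and compressing by \<open>W\<close> turns this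
  average into \<open>W\<^sup>* F(T) W\<close> because \<open>S W = W\<close>.  On the other side the pinching is block diagonal, its
  block on the range of \<open>W\<close> being a unitary copy of \<open>W\<^sup>* T W\<close>, so regularity identifies the
  compression of its image with \<open>F (W\<^sup>* T W)\<close> (\<open>F_pinching_corner\<close>).

  Part (ii) is the case of a column.  Infinite dimension provides isometries \<open>U\<close>, \<open>V\<close> whose ranges
  are complementary orthogonal subspaces, that is, an identification of the space with the direct sum
  of two copies of itself (\<open>ex_doubling\<close>).  Then \<open>W = U X + V Y\<close> is an isometry, and
  \<open>T = U A U\<^sup>* + V B V\<^sup>*\<close> plays the role of \<open>A \<oplus> B\<close>.  Part (i) is part (ii) with \<open>B = 0\<close> and \<open>Y\<close>
  the square root of \<open>1 - C\<^sup>* C\<close> (\<open>ex_contraction_defect\<close>); the extra term \<open>Y\<^sup>* F(0) Y\<close> is at most 0.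

  The Hilbert space theory needed for this is developed first: a Riesz representation on closed
  subspaces, hence adjoints; orthonormal bases and the extension of isometries from them; and square
  roots of \<open>1 - K\<close> for self-adjoint contractions \<open>K\<close>.
\<close>


instance complex_hilbert \<subseteq> banach ..

section \<open>The complex inner product\<close>

lemma cinner_self_real: "Im (cinner x x) = 0"
  using arg_cong[OF cinner_commute[of x x], of Im] by simp

lemma cinner_add_left: "cinner (x + y) z = cinner x z + cinner y z"
  by (metis cinner_add_right cinner_commute complex_cnj_add)

lemma cinner_scaleC_left: "cinner (a *\<^sub>C x) y = cnj a * cinner x y"
  by (metis cinner_commute cinner_scaleC_right complex_cnj_mult)

lemma cinner_zero_right [simp]: "cinner x 0 = 0"
  using cinner_add_right[of x 0 0] by simp

lemma cinner_zero_left [simp]: "cinner 0 x = 0"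
  using cinner_add_left[of 0 0 x] by simp

lemma cinner_scaleR_right: "cinner x (r *\<^sub>R y) = of_real r * cinner x y"
  by (simp add: scaleR_scaleC cinner_scaleC_right)

lemma cinner_scaleR_left: "cinner (r *\<^sub>R x) y = of_real r * cinner x y"
  by (simp add: scaleR_scaleC cinner_scaleC_left)

lemma cinner_minus_right: "cinner x (- y) = - cinner x y"
  using cinner_scaleR_right[of x "-1" y] by simp

lemma cinner_minus_left: "cinner (- x) y = - cinner x y"
  using cinner_scaleR_left[of "-1" x y] by simp

lemma cinner_diff_right: "cinner x (y - z) = cinner x y - cinner x z"
  using cinner_add_right[of x y "- z"] by (simp add: cinner_minus_right)

lemma cinner_diff_left: "cinner (x - y) z = cinner x z - cinner y z"
  using cinner_add_left[of x "- y" z] by (simp add: cinner_minus_left)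

lemma cinner_sum_right: "cinner x (\<Sum>i\<in>I. f i) = (\<Sum>i\<in>I. cinner x (f i))"
  by (induction I rule: infinite_finite_induct) (auto simp: cinner_add_right)

lemmas cinner_simps = cinner_add_left cinner_add_right cinner_diff_left cinner_diff_right
  cinner_scaleR_left cinner_scaleR_right cinner_scaleC_left cinner_scaleC_right

lemma cinner_self: "cinner x x = of_real ((norm x)\<^sup>2)"
  by (simp add: complex_eq_iff cinner_self_real dot_square_norm flip: inner_eq_Re_cinner)

lemma norm_scaleC: "norm (a *\<^sub>C x) = cmod a * norm x"
proof -
  have "cnj a * a = complex_of_real ((cmod a)\<^sup>2)"
    by (simp only: complex_norm_square mult.commute)
  then have "of_real ((norm (a *\<^sub>C x))\<^sup>2) = complex_of_real ((cmod a)\<^sup>2 * (norm x)\<^sup>2)"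
    by (metis cinner_scaleC_left cinner_scaleC_right cinner_self mult.assoc mult.commute of_real_mult)
  then have "(norm (a *\<^sub>C x))\<^sup>2 = (cmod a * norm x)\<^sup>2"
    by (simp only: of_real_eq_iff power_mult_distrib)
  then show ?thesis
    by (rule power2_eq_imp_eq) auto
qed

lemma scaleC_scaleR: "a *\<^sub>C (r *\<^sub>R x) = r *\<^sub>R (a *\<^sub>C x)"
  by (simp add: scaleR_scaleC scaleC_scaleC mult.commute)

lemma bounded_linear_scaleC: "bounded_linear (\<lambda>x. a *\<^sub>C x)"
  by (rule bounded_linear_intro[where K = "cmod a"])
    (simp_all add: scaleC_add_right scaleC_scaleR norm_scaleC)

text \<open>The imaginary part is the real inner product with a rotated vector, so that statements
  about \<^const>\<open>inner\<close> transfer to \<^const>\<open>cinner\<close>.\<close>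

lemma cinner_eq_Complex: "cinner x y = Complex (x \<bullet> y) (x \<bullet> ((- \<i>) *\<^sub>C y))"
  by (simp add: complex_eq_iff inner_eq_Re_cinner cinner_simps cinner_minus_right)

lemma bounded_linear_cinner_right: "bounded_linear (cinner x)"
proof (rule bounded_linear_intro[where K = "2 * norm x"])
  fix y
  have "cmod (cinner x y) \<le> \<bar>x \<bullet> y\<bar> + \<bar>x \<bullet> ((- \<i>) *\<^sub>C y)\<bar>"
    by (metis cinner_eq_Complex cmod_le complex.sel)
  also have "\<dots> \<le> norm x * norm y + norm x * norm ((- \<i>) *\<^sub>C y)"
    by (intro add_mono Cauchy_Schwarz_ineq2)
  finally show "cmod (cinner x y) \<le> norm y * (2 * norm x)"
    by (simp add: norm_scaleC algebra_simps del: complex_vector.scale_minus_left)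
qed (simp_all add: cinner_simps scaleR_conv_of_real)

lemma continuous_on_cinner_right [continuous_intros]:
  "continuous_on S f \<Longrightarrow> continuous_on S (\<lambda>x. cinner a (f x))"
  by (rule bounded_linear.continuous_on[OF bounded_linear_cinner_right])

lemma continuous_on_cinner_left [continuous_intros]:
  "continuous_on S f \<Longrightarrow> continuous_on S (\<lambda>x. cinner (f x) a)"
  by (subst cinner_commute) (intro continuous_intros)

lemma cinner_ext_left:
  assumes "\<And>y. cinner u y = cinner v y"
  shows "u = v"
proof -
  have "cinner (u - v) (u - v) = 0"
    using assms by (simp add: cinner_diff_left)
  then show ?thesis
    by (simp add: cinner_self)
qed

section \<open>Projections and adjoints\<close>

text \<open>The functional \<open>x \<bullet> x - 2 * f x\<close> differs from \<open>(norm (x - a))\<^sup>2\<close> by a constant when \<open>f\<close> is represented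
  by \<open>a\<close>.  It can be minimised without knowing \<open>a\<close>: the parallelogram law makes every minimising
  sequence Cauchy.\<close>
lemma quadratic_minimum_on_closed_subspace:
  fixes M :: "'a::{real_inner,complete_space} set"
  assumes f: "bounded_linear f" and M: "subspace M" "closed M"
  obtains x where "x \<in> M" and "\<And>y. y \<in> M \<Longrightarrow> x \<bullet> x - 2 * f x \<le> y \<bullet> y - 2 * f y"
proof -
  interpret f: bounded_linear f by (rule f)
  define J where "J x = x \<bullet> x - 2 * f x" for x
  obtain B where B: "\<bar>f x\<bar> \<le> norm x * B" for x
    using f.bounded by (auto simp: abs_le_iff)
  have "- B\<^sup>2 \<le> J x" for x
  proof -
    have "0 \<le> (norm x - B)\<^sup>2" by simp
    moreover have "f x \<le> norm x * B" using B[of x] by simp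
    ultimately show ?thesis
      unfolding J_def by (simp add: power2_diff dot_square_norm)
  qed
  then have bdd: "bdd_below (J ` M)" by (rule bdd_belowI2)
  define m where "m = Inf (J ` M)"
  have m_le: "m \<le> J x" if "x \<in> M" for x
    unfolding m_def using bdd that by (simp add: cInf_lower)
  have "J ` M \<noteq> {}" using subspace_0[OF M(1)] by auto
  then have "\<exists>x\<in>M. J x < m + inverse (real (Suc n))" for n
    using cInf_lessD[of "J ` M" "m + inverse (real (Suc n))"] by (auto simp: m_def)
  then obtain s where sM: "\<And>n. s n \<in> M" and s: "\<And>n. J (s n) < m + inverse (real (Suc n))"
    by metis
  \<comment> \<open>The midpoint cannot do better than the infimum, so two near-minimisers are close.\<close>
  have parallelogram: "(norm (x - y))\<^sup>2 \<le> 2 * (J x - m) + 2 * (J y - m)"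
    if "x \<in> M" "y \<in> M" for x y
  proof -
    have "(1/2) *\<^sub>R (x + y) \<in> M"
      using that M(1) by (simp add: subspace_add subspace_scale)
    from m_le[OF this] have "4 * m \<le> 4 * J ((1/2) *\<^sub>R (x + y))" by simp
    also have "\<dots> = 2 * J x + 2 * J y - (norm (x - y))\<^sup>2"
      unfolding J_def power2_norm_eq_inner
      by (simp add: f.scaleR f.add inner_add_left inner_add_right inner_diff_left inner_diff_right
          inner_commute algebra_simps)
    finally show ?thesis by simp
  qed
  have "Cauchy s"
  proof (rule metric_CauchyI)
    fix e :: real assume e: "0 < e"
    then obtain N where N: "inverse (real (Suc N)) < e\<^sup>2 / 4"
      using reals_Archimedean[of "e\<^sup>2 / 4"] by auto
    show "\<exists>N. \<forall>p\<ge>N. \<forall>q\<ge>N. dist (s p) (s q) < e"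
    proof (intro exI[of _ N] allI impI)
      fix p q assume pq: "N \<le> p" "N \<le> q"
      have small: "J (s p) - m < e\<^sup>2 / 4" if "N \<le> p" for p
      proof -
        have "inverse (real (Suc p)) \<le> inverse (real (Suc N))"
          using that by (intro le_imp_inverse_le) auto
        then show ?thesis using s[of p] N by linarith
      qed
      have "(norm (s p - s q))\<^sup>2 \<le> 2 * (J (s p) - m) + 2 * (J (s q) - m)"
        by (rule parallelogram[OF sM sM])
      also have "\<dots> < 2 * (e\<^sup>2 / 4) + 2 * (e\<^sup>2 / 4)"
        using small pq by (intro add_strict_mono mult_strict_left_mono) auto
      finally have "(norm (s p - s q))\<^sup>2 < e\<^sup>2" by simp
      then show "dist (s p) (s q) < e"
        using e by (simp add: dist_norm power2_less_imp_less)
    qed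
  qed
  then obtain x where lim: "s \<longlonglongrightarrow> x"
    using Cauchy_convergent_iff convergent_def by blast
  have xM: "x \<in> M"
    using closed_sequentially[OF M(2) _ lim] sM by blast
  have "(\<lambda>n. J (s n)) \<longlonglongrightarrow> J x"
    unfolding J_def by (intro tendsto_intros lim f.tendsto)
  moreover have "(\<lambda>n. m + inverse (real (Suc n))) \<longlonglongrightarrow> m + 0"
    by (intro tendsto_intros LIMSEQ_inverse_real_of_nat)
  ultimately have "J x \<le> m"
    using LIMSEQ_le[of "\<lambda>n. J (s n)" "J x" "\<lambda>n. m + inverse (real (Suc n))" "m + 0"] s
    by (auto intro: less_imp_le)
  then show ?thesis
    using that[OF xM] m_le unfolding J_def by (meson order_trans)
qed

text \<open>At a minimum of the quadratic functional the derivative in every direction of \<open>M\<close> vanishes.  For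
  \<open>M = UNIV\<close> this is the Riesz representation theorem; for \<open>f y = z \<bullet> y\<close> it gives the orthogonal
  projection of \<open>z\<close> onto \<open>M\<close>.\<close>
lemma riesz_on_closed_subspace:
  fixes M :: "'a::{real_inner,complete_space} set"
  assumes f: "bounded_linear f" and M: "subspace M" "closed M"
  obtains x where "x \<in> M" and "\<And>y. y \<in> M \<Longrightarrow> x \<bullet> y = f y"
proof -
  interpret f: bounded_linear f by (rule f)
  obtain x where x: "x \<in> M" and min: "\<And>y. y \<in> M \<Longrightarrow> x \<bullet> x - 2 * f x \<le> y \<bullet> y - 2 * f y"
    using quadratic_minimum_on_closed_subspace[OF assms] by metis
  have "x \<bullet> y = f y" if y: "y \<in> M" for y
  proof -
    \<comment> \<open>The step \<open>t\<close> nearly minimises \<open>t\<^sup>2 q + 2 t d\<close>; adding 1 to \<open>q\<close> avoids dividing by zero.\<close>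
    define d q t where "d = x \<bullet> y - f y" and "q = y \<bullet> y" and "t = - d / (q + 1)"
    have q: "0 \<le> q" unfolding q_def by simp
    have "x + t *\<^sub>R y \<in> M" using x y M(1) by (simp add: subspace_add subspace_scale)
    from min[OF this] have "0 \<le> t * t * q + 2 * t * d"
      unfolding d_def q_def
      by (simp add: f.add f.scaleR inner_add_left inner_add_right inner_commute algebra_simps)
    then have "0 \<le> (t * t * q + 2 * t * d) * (q + 1)\<^sup>2"
      by simp
    also have "\<dots> = (t * (q + 1))\<^sup>2 * q + 2 * (t * (q + 1)) * d * (q + 1)"
      by (simp add: power2_eq_square algebra_simps)
    also have "t * (q + 1) = - d"
      unfolding t_def using q by simp
    finally have "d * d * (q + 2) \<le> 0"
      by (simp add: power2_eq_square algebra_simps)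
    then have "d * d \<le> 0" using q by (simp add: mult_le_0_iff)
    then show ?thesis unfolding d_def by (auto simp: mult_le_0_iff)
  qed
  then show ?thesis using that x by blast
qed

lemma complex_linear_scaleC: "complex_linear T \<Longrightarrow> T (c *\<^sub>C x) = c *\<^sub>C T x"
  by (simp add: complex_linear_def)

lemma ex_adjoint:
  assumes T: "complex_linear T"
  shows "\<exists>S. complex_linear S \<and> (\<forall>x y. cinner (blinfun_apply S x) y = cinner x (T y))"
proof -
  have "\<exists>z. \<forall>y. z \<bullet> y = x \<bullet> T y" for x
    using riesz_on_closed_subspace[of "\<lambda>y. x \<bullet> T y" UNIV]
    by (metis UNIV_I bounded_linear_inner_right_comp blinfun.bounded_linear_right closed_UNIV subspace_UNIV)
  then obtain r where r: "r x \<bullet> y = x \<bullet> T y" for x y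
    by metis
  have adj: "cinner (r x) y = cinner x (T y)" for x y
    using r T by (simp add: cinner_eq_Complex flip: complex_linear_scaleC)
  have add: "r (x + y) = r x + r y" for x y
    by (rule cinner_ext_left) (simp add: adj cinner_simps)
  have scale: "r (c *\<^sub>C x) = c *\<^sub>C r x" for c x
    by (rule cinner_ext_left) (simp add: adj cinner_simps)
  have bd: "norm (r x) \<le> norm x * norm T" for x
  proof (cases "r x = 0")
    case False
    have "norm (r x) * norm (r x) = x \<bullet> T (r x)"
      by (metis r power2_norm_eq_inner power2_eq_square)
    also have "\<dots> \<le> norm x * norm (T (r x))" by (rule norm_cauchy_schwarz)
    also have "\<dots> \<le> norm x * (norm T * norm (r x))"
      by (intro mult_left_mono norm_blinfun) simp
    finally show ?thesis using False by simp
  qed simp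
  have "bounded_linear r"
    using bd by (intro bounded_linear_intro[where K = "norm T"]) (auto simp: add scale scaleR_scaleC)
  then have "blinfun_apply (Blinfun r) = r"
    by (rule bounded_linear_Blinfun_apply)
  then show ?thesis
    using adj scale unfolding complex_linear_def by metis
qed

lemma cadjoint_eqI:
  assumes "\<And>x y. cinner (blinfun_apply S x) y = cinner x (blinfun_apply T y)"
  shows "cadjoint T = S"
  unfolding cadjoint_def
proof (rule the_equality)
  fix R assume "\<forall>x y. cinner (blinfun_apply R x) y = cinner x (T y)"
  then show "R = S"
    using assms by (intro blinfun_eqI cinner_ext_left) simp
qed (use assms in blast)

lemma
  assumes "complex_linear T"
  shows cinner_cadjoint_left: "cinner (cadjoint T x) y = cinner x (T y)"
    and complex_linear_cadjoint: "complex_linear (cadjoint T)"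
proof -
  obtain S where "complex_linear S" and S: "\<And>x y. cinner (blinfun_apply S x) y = cinner x (T y)"
    using ex_adjoint[OF assms] by blast
  moreover have "cadjoint T = S" using S by (rule cadjoint_eqI)
  ultimately show "cinner (cadjoint T x) y = cinner x (T y)" "complex_linear (cadjoint T)"
    by auto
qed

lemma cinner_cadjoint_right:
  assumes "complex_linear T"
  shows "cinner x (cadjoint T y) = cinner (T x) y"
  by (metis assms cinner_cadjoint_left cinner_commute)

lemmas cadjoint_simps = cinner_cadjoint_left cinner_cadjoint_right

lemma cadjoint_cadjoint: "complex_linear T \<Longrightarrow> cadjoint (cadjoint T) = T"
  by (rule cadjoint_eqI) (simp add: cadjoint_simps)

lemma complex_linear_add: "complex_linear S \<Longrightarrow> complex_linear T \<Longrightarrow> complex_linear (S + T)"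
  by (simp add: complex_linear_def blinfun.add_left scaleC_add_right)

lemma complex_linear_scaleR: "complex_linear T \<Longrightarrow> complex_linear (r *\<^sub>R T)"
  by (simp add: complex_linear_def blinfun.scaleR_left scaleC_scaleR)

lemma complex_linear_diff: "complex_linear S \<Longrightarrow> complex_linear T \<Longrightarrow> complex_linear (S - T)"
  by (simp add: complex_linear_def blinfun.diff_left complex_vector.scale_right_diff_distrib)

lemma complex_linear_compose: "complex_linear S \<Longrightarrow> complex_linear T \<Longrightarrow> complex_linear (S o\<^sub>L T)"
  by (simp add: complex_linear_def)

lemma complex_linear_zero: "complex_linear 0"
  by (simp add: complex_linear_def)

lemma complex_linear_id: "complex_linear id_blinfun"
  by (simp add: complex_linear_def)

lemmas complex_linear_intros = complex_linear_add complex_linear_diff complex_linear_scaleR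
  complex_linear_compose complex_linear_zero complex_linear_id complex_linear_cadjoint

lemma self_adjoint_iff:
  "self_adjoint T \<longleftrightarrow> complex_linear T \<and> (\<forall>x y. cinner (T x) y = cinner x (T y))"
  unfolding self_adjoint_def by (metis cadjoint_eqI cinner_cadjoint_left)

lemma positive_op_iff:
  "positive_op T \<longleftrightarrow> complex_linear T \<and> (\<forall>x y. cinner (T x) y = cinner x (T y)) \<and> (\<forall>x. 0 \<le> Re (cinner x (T x)))"
  by (auto simp: positive_op_def self_adjoint_iff)

lemma positive_op_zero: "positive_op 0"
  by (simp add: positive_op_iff complex_linear_zero)

lemma positive_op_add: "positive_op S \<Longrightarrow> positive_op T \<Longrightarrow> positive_op (S + T)"
  by (auto simp: positive_op_iff complex_linear_add blinfun.add_left cinner_simps)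

lemma positive_op_compress:
  assumes "complex_linear W" "positive_op T"
  shows "positive_op (cadjoint W o\<^sub>L T o\<^sub>L W)"
  using assms by (auto simp: positive_op_iff cadjoint_simps complex_linear_compose complex_linear_cadjoint)

lemma positive_op_conjugate:
  assumes "complex_linear W" "positive_op T"
  shows "positive_op (W o\<^sub>L T o\<^sub>L cadjoint W)"
  using positive_op_compress[of "cadjoint W" T] assms
  by (simp add: cadjoint_cadjoint complex_linear_cadjoint)

lemma ocomplement_UNIV [simp]: "ocomplement UNIV = {0}"
proof -
  have "x = 0" if "\<forall>y. cinner y x = 0" for x :: 'a
    using that[rule_format, of x] by (simp add: cinner_self)
  then show ?thesis by (auto simp: ocomplement_def)
qed

lemma bops_UNIV: "bops UNIV UNIV = {T. complex_linear T}"
  by (auto simp: bops_def blinfun.zero_right)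

lemma pos_tuples_UNIV: "A \<in> pos_tuples UNIV \<longleftrightarrow> (\<forall>i. positive_op (A $ i))"
  by (auto simp: pos_tuples_def bops_UNIV positive_op_iff)

section \<open>Orthonormal bases\<close>

definition orthonormal :: "'h::complex_hilbert set \<Rightarrow> bool" where
  "orthonormal E \<longleftrightarrow> (\<forall>e\<in>E. \<forall>e'\<in>E. cinner e e' = (if e = e' then 1 else 0))"

definition orthonormal_basis :: "'h::complex_hilbert set \<Rightarrow> bool" where
  "orthonormal_basis E \<longleftrightarrow> orthonormal E \<and> (\<forall>x. (\<forall>e\<in>E. cinner e x = 0) \<longrightarrow> x = 0)"

text \<open>A maximal orthonormal set is a basis: a nonzero vector orthogonal to it could be normalised and added.\<close>
lemma ex_orthonormal_basis: "\<exists>E :: 'h::complex_hilbert set. orthonormal_basis E"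
proof -
  have "\<exists>E\<in>Collect orthonormal. \<forall>E'\<in>Collect orthonormal. E \<subseteq> E' \<longrightarrow> E' = (E :: 'h set)"
  proof (rule subset_Zorn')
    fix C :: "'h set set" assume C: "subset.chain (Collect orthonormal) C"
    have "cinner e e' = (if e = e' then 1 else 0)" if ee: "e \<in> \<Union>C" "e' \<in> \<Union>C" for e e'
    proof -
      obtain X Y where "X \<in> C" "Y \<in> C" "e \<in> X" "e' \<in> Y" using ee by blast
      moreover from this have "X \<subseteq> Y \<or> Y \<subseteq> X"
        using C by (auto simp: subset_chain_def)
      ultimately obtain Z where "Z \<in> C" "e \<in> Z" "e' \<in> Z" by blast
      moreover from this have "orthonormal Z"
        using C by (auto simp: subset_chain_def)
      ultimately show ?thesis by (simp add: orthonormal_def)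
    qed
    then show "\<Union>C \<in> Collect orthonormal" by (simp add: orthonormal_def)
  qed
  then obtain E :: "'h set" where E: "orthonormal E"
    and max: "\<And>E'. orthonormal E' \<Longrightarrow> E \<subseteq> E' \<Longrightarrow> E' = E"
    by auto
  have "x = 0" if x: "\<forall>e\<in>E. cinner e x = 0" for x
  proof (rule ccontr)
    assume "x \<noteq> 0"
    define u where "u = inverse (norm x) *\<^sub>R x"
    have u: "cinner u u = 1"
      using \<open>x \<noteq> 0\<close> unfolding cinner_self by (simp add: u_def)
    have "cinner e u = 0 \<and> cinner u e = 0" if "e \<in> E" for e
      using x that cinner_commute[of u e] by (simp add: u_def cinner_simps)
    then have "orthonormal (insert u E)"
      using E u by (auto simp: orthonormal_def)
    then have "u \<in> E" using max by blast
    then have "cinner u x = 0" using x by blast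
    then have "cinner u u = 0" by (simp add: u_def cinner_simps)
    with u show False by simp
  qed
  then show ?thesis using E unfolding orthonormal_basis_def by blast
qed

text \<open>The difference between a vector and its projection onto the subspace is orthogonal to the basis.\<close>
lemma closed_csubspace_containing_basis:
  assumes E: "orthonormal_basis E" and M: "complex_vector.subspace M" "closed M" and sub: "E \<subseteq> M"
  shows "M = UNIV"
proof -
  have "x \<in> M" for x
  proof -
    have "subspace M"
      using M(1) unfolding complex_vector.subspace_def subspace_def by (simp add: scaleR_scaleC)
    then obtain p where p: "p \<in> M" and inner: "\<And>y. y \<in> M \<Longrightarrow> p \<bullet> y = x \<bullet> y"
      using riesz_on_closed_subspace[of "\<lambda>y. x \<bullet> y" M] M(2) bounded_linear_inner_right by metis
    have "cinner (x - p) y = 0" if "y \<in> M" for y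
      using inner[OF that] inner[of "(- \<i>) *\<^sub>C y"] complex_vector.subspace_scale[OF M(1) that]
      by (simp add: cinner_eq_Complex inner_diff_left complex_eq_iff
          del: complex_vector.scale_minus_left)
    then have "\<forall>e\<in>E. cinner e (x - p) = 0"
      using sub by (metis cinner_commute complex_cnj_zero subsetD)
    then have "x - p = 0" using E unfolding orthonormal_basis_def by blast
    then show ?thesis using p by simp
  qed
  then show ?thesis by blast
qed

text \<open>A finite orthonormal basis spans algebraically, since a vector agrees with its finite Fourier sum.\<close>
lemma infinite_orthonormal_basis:
  fixes E :: "'h::complex_hilbert set"
  assumes "infinite_dimensional TYPE('h)" and E: "orthonormal_basis E"
  shows "infinite E"
proof
  assume fin: "finite E"
  have "x \<in> complex_vector.span E" for x
  proof -
    define p where "p = (\<Sum>e\<in>E. cinner e x *\<^sub>C e)"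
    have "cinner e (x - p) = 0" if e: "e \<in> E" for e
    proof -
      have "cinner e p = (\<Sum>e'\<in>E. if e' = e then cinner e x else 0)"
        unfolding p_def cinner_sum_right
        using E e by (intro sum.cong) (auto simp: cinner_simps orthonormal_basis_def orthonormal_def)
      then show ?thesis using fin e by (simp add: cinner_simps)
    qed
    then have "x - p = 0" using E unfolding orthonormal_basis_def by blast
    moreover have "p \<in> complex_vector.span E"
      unfolding p_def
      by (intro complex_vector.span_sum complex_vector.span_scale complex_vector.span_base)
    ultimately show ?thesis by simp
  qed
  then have "complex_vector.span E = UNIV" by blast
  with fin assms(1) show False unfolding infinite_dimensional_def by blast
qed

lemma closed_equalizer: "closed {x. blinfun_apply S x = blinfun_apply T x}"
  by (intro closed_Collect_eq continuous_intros)

lemma csubspace_equalizer: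
  "complex_linear S \<Longrightarrow> complex_linear T \<Longrightarrow>
    complex_vector.subspace {x. blinfun_apply S x = blinfun_apply T x}"
  by (auto simp: complex_vector.subspace_def complex_linear_def blinfun.zero_right blinfun.add_right)

lemma complex_linear_eq_on_basis:
  assumes "orthonormal_basis E" "complex_linear S" "complex_linear T"
    and "\<And>e. e \<in> E \<Longrightarrow> blinfun_apply S e = blinfun_apply T e"
  shows "S = T"
  using closed_csubspace_containing_basis[OF assms(1) csubspace_equalizer[OF assms(2,3)] closed_equalizer]
    assms(4)
  by (intro blinfun_eqI) blast

lemma csubspace_closure:
  fixes M :: "'h::complex_hilbert set"
  assumes M: "complex_vector.subspace M"
  shows "complex_vector.subspace (closure M)"
  unfolding complex_vector.subspace_def
proof (intro conjI ballI allI)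
  show "0 \<in> closure M"
    using complex_vector.subspace_0[OF M] closure_subset by blast
  show "x + y \<in> closure M" if xy: "x \<in> closure M" "y \<in> closure M" for x y
  proof -
    obtain s where s: "\<forall>n. s n \<in> M" "s \<longlonglongrightarrow> x"
      using xy closure_sequential by blast
    obtain t where t: "\<forall>n. t n \<in> M" "t \<longlonglongrightarrow> y"
      using xy closure_sequential by blast
    from s t have "\<forall>n. s n + t n \<in> M" "(\<lambda>n. s n + t n) \<longlonglongrightarrow> x + y"
      using complex_vector.subspace_add[OF M] tendsto_add[of s x sequentially t y] by simp_all
    then show ?thesis unfolding closure_sequential by (intro exI[of _ "\<lambda>n. s n + t n"] conjI)
  qed
  show "c *\<^sub>C x \<in> closure M" if x: "x \<in> closure M" for c x
  proof -
    obtain s where "\<forall>n. s n \<in> M" "s \<longlonglongrightarrow> x"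
      using x closure_sequential by blast
    then have "\<forall>n. c *\<^sub>C s n \<in> M" "(\<lambda>n. c *\<^sub>C s n) \<longlonglongrightarrow> c *\<^sub>C x"
      using complex_vector.subspace_scale[OF M] bounded_linear.tendsto[OF bounded_linear_scaleC]
      by simp_all
    then show ?thesis unfolding closure_sequential by (intro exI[of _ "\<lambda>n. c *\<^sub>C s n"] conjI)
  qed
qed

definition isometry :: "('h::complex_hilbert \<Rightarrow>\<^sub>L 'h) \<Rightarrow> bool" where
  "isometry V \<longleftrightarrow> complex_linear V \<and> (\<forall>x y. cinner (V x) (V y) = cinner x y)"

text \<open>Polarisation recovers first the real and then the complex inner product from the norm.\<close>
lemma isometryI_norm:
  assumes V: "complex_linear V" and norm: "\<And>x. norm (blinfun_apply V x) = norm x"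
  shows "isometry V"
proof -
  have "blinfun_apply V x \<bullet> blinfun_apply V y = x \<bullet> y" for x y
    unfolding dot_norm by (simp add: norm flip: blinfun.add_right)
  then show ?thesis
    unfolding isometry_def by (simp add: V cinner_eq_Complex flip: complex_linear_scaleC)
qed

text \<open>The linear extension of \<open>f\<close> to the algebraic span preserves inner products, hence is uniformly
  continuous and extends to the closure of the span, which is the whole space.\<close>
lemma ex_isometry_extension:
  fixes E :: "'h::complex_hilbert set"
  assumes E: "orthonormal_basis E"
    and f: "\<And>e e'. e \<in> E \<Longrightarrow> e' \<in> E \<Longrightarrow> cinner (f e) (f e') = cinner e e'"
  obtains V where "isometry V" "\<And>e. e \<in> E \<Longrightarrow> blinfun_apply V e = f e"
proof -
  interpret cpair: vector_space_pair "scaleC :: complex \<Rightarrow> 'h \<Rightarrow> 'h" "scaleC :: complex \<Rightarrow> 'h \<Rightarrow> 'h"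
    by unfold_locales
  let ?S = "complex_vector.span E"
  \<comment> \<open>Each basis vector is orthogonal to the span of the others.\<close>
  have "complex_vector.independent E"
  proof
    assume "complex_vector.dependent E"
    then obtain e where e: "e \<in> E" "e \<in> complex_vector.span (E - {e})"
      unfolding complex_vector.dependent_def by blast
    have "cinner e e = 0"
      using e(2)
    proof (rule complex_vector.span_induct[where P = "\<lambda>x. cinner e x = 0"])
      show "complex_vector.subspace {x. cinner e x = 0}"
        by (auto simp: complex_vector.subspace_def cinner_simps)
      show "cinner e x = 0" if "x \<in> E - {e}" for x
        using E e(1) that by (auto simp: orthonormal_basis_def orthonormal_def)
    qed
    then show False
      using E e(1) by (auto simp: orthonormal_basis_def orthonormal_def)
  qed
  then obtain g where g: "Vector_Spaces.linear scaleC scaleC g" and gf: "\<And>e. e \<in> E \<Longrightarrow> g e = f e"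
    using cpair.linear_independent_extend by metis
  interpret g: Vector_Spaces.linear scaleC scaleC g by (rule g)
  have pres_E: "cinner (g x) (g e) = cinner x e" if "x \<in> ?S" "e \<in> E" for x e
    using that(1)
  proof (rule complex_vector.span_induct)
    show "complex_vector.subspace {x. cinner (g x) (g e) = cinner x e}"
      by (auto simp: complex_vector.subspace_def cinner_simps g.zero g.add g.scale)
  qed (use f gf that(2) in auto)
  have pres: "cinner (g x) (g y) = cinner x y" if "x \<in> ?S" "y \<in> ?S" for x y
    using that(2)
  proof (rule complex_vector.span_induct)
    show "complex_vector.subspace {y. cinner (g x) (g y) = cinner x y}"
      by (auto simp: complex_vector.subspace_def cinner_simps g.zero g.add g.scale)
  qed (use pres_E that(1) in auto)
  have norm_g: "norm (g x) = norm x" if "x \<in> ?S" for x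
    using pres[OF that that] by (simp add: cinner_self flip: of_real_power)
  have "uniformly_continuous_on ?S g"
    unfolding uniformly_continuous_on_def dist_norm
    by (metis complex_vector.span_diff g.diff norm_g)
  then obtain h where h: "uniformly_continuous_on (closure ?S) h" and gh: "\<And>x. x \<in> ?S \<Longrightarrow> g x = h x"
    by (rule uniformly_continuous_on_extension_on_closure) blast
  have dense: "closure ?S = UNIV"
    using closed_csubspace_containing_basis[OF E csubspace_closure[OF complex_vector.subspace_span]]
      closure_subset complex_vector.span_superset by blast
  have cont: "continuous_on UNIV h"
    using h uniformly_continuous_imp_continuous unfolding dense by blast
  have h_lim: "(\<lambda>n. g (s n)) \<longlonglongrightarrow> h x" if "\<And>n. s n \<in> ?S" "s \<longlonglongrightarrow> x" for s x
    using continuous_on_tendsto_compose[OF cont that(2)] gh that(1) by simp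
  have approx: "\<exists>s. (\<forall>n. s n \<in> ?S) \<and> s \<longlonglongrightarrow> x \<and> (\<lambda>n. g (s n)) \<longlonglongrightarrow> h x" for x
  proof -
    obtain s where "\<forall>n. s n \<in> ?S" "s \<longlonglongrightarrow> x"
      using dense closure_sequential[of x ?S] by blast
    then show ?thesis using h_lim[of s x] by blast
  qed
  have h_add: "h (x + y) = h x + h y" for x y
  proof -
    obtain s t where s: "\<And>n. s n \<in> ?S" "s \<longlonglongrightarrow> x" "(\<lambda>n. g (s n)) \<longlonglongrightarrow> h x"
      and t: "\<And>n. t n \<in> ?S" "t \<longlonglongrightarrow> y" "(\<lambda>n. g (t n)) \<longlonglongrightarrow> h y"
      using approx[of x] approx[of y] by blast
    have "(\<lambda>n. g (s n + t n)) \<longlonglongrightarrow> h (x + y)"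
      using s t by (intro h_lim complex_vector.span_add tendsto_add) auto
    moreover have "(\<lambda>n. g (s n + t n)) \<longlonglongrightarrow> h x + h y"
      unfolding g.add using s t by (intro tendsto_add)
    ultimately show ?thesis by (rule LIMSEQ_unique)
  qed
  have h_scale: "h (c *\<^sub>C x) = c *\<^sub>C h x" for c x
  proof -
    obtain s where s: "\<And>n. s n \<in> ?S" "s \<longlonglongrightarrow> x" "(\<lambda>n. g (s n)) \<longlonglongrightarrow> h x"
      using approx[of x] by blast
    have "(\<lambda>n. g (c *\<^sub>C s n)) \<longlonglongrightarrow> h (c *\<^sub>C x)"
      using s by (intro h_lim complex_vector.span_scale bounded_linear.tendsto[OF bounded_linear_scaleC])
    moreover have "(\<lambda>n. g (c *\<^sub>C s n)) \<longlonglongrightarrow> c *\<^sub>C h x"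
      unfolding g.scale using s by (intro bounded_linear.tendsto[OF bounded_linear_scaleC])
    ultimately show ?thesis by (rule LIMSEQ_unique)
  qed
  have h_norm: "norm (h x) = norm x" for x
  proof -
    obtain s where s: "\<And>n. s n \<in> ?S" "s \<longlonglongrightarrow> x" "(\<lambda>n. g (s n)) \<longlonglongrightarrow> h x"
      using approx[of x] by blast
    then have "(\<lambda>n. norm (s n)) \<longlonglongrightarrow> norm (h x)"
      using tendsto_norm[OF s(3)] by (simp add: norm_g)
    then show ?thesis using tendsto_norm[OF s(2)] LIMSEQ_unique by blast
  qed
  have "bounded_linear h"
    by (rule bounded_linear_intro[where K = 1]) (simp_all add: h_add h_scale h_norm scaleR_scaleC)
  then have app: "blinfun_apply (Blinfun h) = h"
    by (rule bounded_linear_Blinfun_apply)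
  show ?thesis
  proof (rule that)
    show "isometry (Blinfun h)"
      by (rule isometryI_norm) (simp_all add: app complex_linear_def h_scale h_norm)
    show "Blinfun h e = f e" if "e \<in> E" for e
      using that gf gh complex_vector.span_base app by metis
  qed
qed

lemma isometry_cadjoint: "isometry V \<Longrightarrow> cadjoint V (V x) = x"
  by (rule cinner_ext_left) (simp add: isometry_def cadjoint_simps)

lemma isometryI_cadjoint:
  assumes "complex_linear V" "\<And>x. cadjoint V (blinfun_apply V x) = x"
  shows "isometry V"
  unfolding isometry_def by (metis assms cinner_cadjoint_left)

text \<open>An infinite basis is equinumerous with the disjoint union of two copies of itself; the two halves
  of such a bijection extend to isometries with complementary orthogonal ranges.\<close>
lemma ex_doubling:
  assumes "infinite_dimensional TYPE('h::complex_hilbert)"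
  obtains V W :: "'h::complex_hilbert \<Rightarrow>\<^sub>L 'h"
  where "isometry V" "isometry W" "\<And>x. cadjoint V (W x) = 0" "\<And>x. cadjoint W (V x) = 0"
    and "\<And>x. V (cadjoint V x) + W (cadjoint W x) = x"
proof -
  obtain E :: "'h set" where E: "orthonormal_basis E" using ex_orthonormal_basis by blast
  obtain b where b: "bij_betw b (E <+> E) E"
    using card_of_Plus_infinite1[OF infinite_orthonormal_basis[OF assms E] card_of_mono1[OF subset_refl]]
      card_of_ordIso by blast
  have bE: "b (Inl e) \<in> E" "b (Inr e) \<in> E" if "e \<in> E" for e
    using b that by (auto simp: bij_betw_def)
  have b_eq: "b z = b z' \<longleftrightarrow> z = z'" if "z \<in> E <+> E" "z' \<in> E <+> E" for z z'
    using b that by (auto simp: bij_betw_def inj_on_def)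
  have ortho: "cinner (b z) (b z') = (if z = z' then 1 else 0)"
    if "z \<in> E <+> E" "z' \<in> E <+> E" for z z'
    using E bE b_eq[OF that] that unfolding orthonormal_basis_def orthonormal_def
    by (metis bij_betwE b)
  have orthoE: "cinner e e' = (if e = e' then 1 else 0)" if "e \<in> E" "e' \<in> E" for e e'
    using E that unfolding orthonormal_basis_def orthonormal_def by blast
  obtain V where V: "isometry V" and Ve: "\<And>e. e \<in> E \<Longrightarrow> blinfun_apply V e = b (Inl e)"
    using ex_isometry_extension[OF E, of "\<lambda>e. b (Inl e)"] by (auto simp: ortho orthoE InlI)
  obtain W where W: "isometry W" and We: "\<And>e. e \<in> E \<Longrightarrow> blinfun_apply W e = b (Inr e)"
    using ex_isometry_extension[OF E, of "\<lambda>e. b (Inr e)"] by (auto simp: ortho orthoE InrI)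
  have lin: "complex_linear V" "complex_linear W" using V W by (auto simp: isometry_def)
  have basis_zero: "x = 0" if "\<And>e. e \<in> E \<Longrightarrow> cinner e x = 0" for x
    using E that unfolding orthonormal_basis_def by blast
  have "cadjoint V o\<^sub>L W = 0"
    by (rule complex_linear_eq_on_basis[OF E])
      (auto intro!: complex_linear_intros lin basis_zero
        simp: cadjoint_simps lin Ve We ortho InlI InrI blinfun.zero_left)
  then have VW: "cadjoint V (W x) = 0" for x
    by (metis blinfun_apply_blinfun_compose blinfun.zero_left)
  have "cadjoint W o\<^sub>L V = 0"
    by (rule complex_linear_eq_on_basis[OF E])
      (auto intro!: complex_linear_intros lin basis_zero
        simp: cadjoint_simps lin Ve We ortho InlI InrI blinfun.zero_left)
  then have WV: "cadjoint W (V x) = 0" for x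
    by (metis blinfun_apply_blinfun_compose blinfun.zero_left)
  have "(V o\<^sub>L cadjoint V) + (W o\<^sub>L cadjoint W) = id_blinfun"
  proof (rule complex_linear_eq_on_basis[OF E])
    fix e assume "e \<in> E"
    then obtain z where z: "z \<in> E <+> E" "e = b z"
      using b by (auto simp: bij_betw_def)
    then consider e' where "e' \<in> E" "e = V e'" | e' where "e' \<in> E" "e = W e'"
      using Ve We by (metis PlusE)
    then show "((V o\<^sub>L cadjoint V) + (W o\<^sub>L cadjoint W)) e = id_blinfun e"
      by cases (simp_all add: blinfun.add_left isometry_cadjoint V W VW WV blinfun.zero_right)
  qed (intro complex_linear_intros lin)+
  then have "V (cadjoint V x) + W (cadjoint W x) = x" for x
    by (metis blinfun_apply_blinfun_compose blinfun.add_left blinfun_apply_id_blinfun id_apply)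
  then show ?thesis using that V W VW WV by blast
qed

section \<open>The defect operator of a contraction\<close>

lemma norm_cadjoint_le:
  assumes T: "complex_linear T"
  shows "norm (cadjoint T) \<le> norm T"
proof (rule norm_blinfun_bound)
  fix x
  let ?y = "cadjoint T x"
  show "norm ?y \<le> norm T * norm x"
  proof (cases "?y = 0")
    case False
    have "norm ?y * norm ?y = x \<bullet> T ?y"
      unfolding inner_eq_Re_cinner
      by (simp add: T cinner_self power2_eq_square flip: cinner_cadjoint_left)
    also have "\<dots> \<le> norm x * (norm T * norm ?y)"
      by (meson norm_cauchy_schwarz norm_blinfun mult_left_mono norm_ge_zero order_trans)
    finally show ?thesis using False by (simp add: mult.commute)
  qed simp
qed simp

text \<open>Writing the root as \<open>1 - L\<close>, the equation \<open>(1 - L)\<^sup>2 = 1 - K\<close> becomes the fixed point equation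
  \<open>L = (K + L\<^sup>2) / 2\<close>.  Iterating it from 0 converges in norm, because the increments are dominated by
  those of the scalar iteration with \<open>K\<close> replaced by 1, which is increasing and bounded by 1.\<close>
lemma ex_sqrt_id_minus:
  assumes K: "self_adjoint K" "norm K \<le> 1"
  obtains Y where "self_adjoint Y" "Y o\<^sub>L Y = id_blinfun - K"
proof -
  define Z where "Z = rec_nat 0 (\<lambda>_ Z. (1/2) *\<^sub>R (K + (Z o\<^sub>L Z)))"
  have Z_0: "Z 0 = 0" and Z_Suc: "Z (Suc n) = (1/2) *\<^sub>R (K + (Z n o\<^sub>L Z n))" for n
    by (simp_all add: Z_def)
  define z :: "nat \<Rightarrow> real" where "z = rec_nat 0 (\<lambda>_ z. (1 + z * z) / 2)"
  have z_0: "z 0 = 0" and z_Suc: "z (Suc n) = (1 + z n * z n) / 2" for n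
    by (simp_all add: z_def)
  have z_bounds: "0 \<le> z n \<and> z n \<le> 1" for n
  proof (induction n)
    case (Suc n)
    then show ?case using mult_mono[of "z n" 1 "z n" 1] by (auto simp: z_Suc)
  qed (simp add: z_0)
  have z_inc: "z n \<le> z (Suc n)" for n
  proof -
    have "0 \<le> (1 - z n) * (1 - z n)" by simp
    then show ?thesis by (simp add: z_Suc algebra_simps)
  qed
  have norm_Z: "norm (Z n) \<le> z n" for n
  proof (induction n)
    case (Suc n)
    have "norm (K + (Z n o\<^sub>L Z n)) \<le> norm K + norm (Z n) * norm (Z n)"
      by (intro norm_triangle_le add_left_mono norm_blinfun_compose)
    also have "\<dots> \<le> 1 + z n * z n"
      using K(2) Suc z_bounds[of n] by (intro add_mono mult_mono) auto
    finally show ?case by (simp add: Z_Suc z_Suc)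
  qed (simp add: Z_0 z_0)
  have norm_step: "norm (Z (Suc n) - Z n) \<le> z (Suc n) - z n" for n
  proof (induction n)
    case 0
    show ?case using norm_Z[of 1] by (simp add: Z_0 z_0)
  next
    case (Suc n)
    let ?D = "Z (Suc n) - Z n" and ?d = "z (Suc n) - z n"
    have "Z (Suc (Suc n)) - Z (Suc n) = (1/2) *\<^sub>R ((Z (Suc n) o\<^sub>L Z (Suc n)) - (Z n o\<^sub>L Z n))"
      unfolding Z_Suc[of "Suc n"] Z_Suc[of n] by (simp add: scaleR_right_diff_distrib[symmetric])
    \<comment> \<open>The noncommutative difference of squares.\<close>
    also have "(Z (Suc n) o\<^sub>L Z (Suc n)) - (Z n o\<^sub>L Z n) = (Z (Suc n) o\<^sub>L ?D) + (?D o\<^sub>L Z n)"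
      by (rule blinfun_eqI) (simp add: blinfun.bilinear_simps)
    finally have "norm (Z (Suc (Suc n)) - Z (Suc n)) = 1/2 * norm ((Z (Suc n) o\<^sub>L ?D) + (?D o\<^sub>L Z n))"
      by simp
    also have "\<dots> \<le> 1/2 * (norm (Z (Suc n)) * norm ?D + norm ?D * norm (Z n))"
      by (intro mult_left_mono norm_triangle_le add_mono norm_blinfun_compose) simp
    also have "\<dots> \<le> 1/2 * (z (Suc n) * ?d + ?d * z n)"
      using Suc norm_Z[of n] norm_Z[of "Suc n"] z_inc[of n] z_bounds
      by (intro mult_left_mono add_mono mult_mono) auto
    also have "\<dots> = z (Suc (Suc n)) - z (Suc n)"
      unfolding z_Suc[of "Suc n"] by (subst (3) z_Suc) (simp add: algebra_simps)
    finally show ?case .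
  qed
  have "incseq z" using z_inc by (rule incseq_SucI)
  then have "convergent z"
    using z_bounds by (metis incseq_convergent convergentI)
  then have "summable (\<lambda>n. z (Suc n) - z n)"
    using telescope_summable convergent_def by blast
  then have "summable (\<lambda>n. Z (Suc n) - Z n)"
    by (rule summable_comparison_test[rotated]) (use norm_step in auto)
  then have "convergent (\<lambda>n. \<Sum>k<n. Z (Suc k) - Z k)"
    by (simp add: summable_iff_convergent)
  then obtain L where L: "Z \<longlonglongrightarrow> L"
    by (auto simp: sum_lessThan_telescope Z_0 convergent_def)
  have "(\<lambda>n. Z (Suc n)) \<longlonglongrightarrow> (1/2) *\<^sub>R (K + (L o\<^sub>L L))"
    unfolding Z_Suc by (intro tendsto_intros L bounded_bilinear.tendsto[OF bounded_bilinear_blinfun_compose])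
  moreover have "(\<lambda>n. Z (Suc n)) \<longlonglongrightarrow> L"
    using L by (rule LIMSEQ_Suc)
  ultimately have L_eq: "L = (1/2) *\<^sub>R (K + (L o\<^sub>L L))"
    by (rule LIMSEQ_unique[rotated])
  have lin_Z: "complex_linear (Z n)" for n
    using K(1) by (induction n) (auto simp: Z_0 Z_Suc self_adjoint_def intro!: complex_linear_intros)
  have sa_Z: "cinner (Z n x) y = cinner x (Z n y)" for n x y
    using K(1)
    by (induction n arbitrary: x y) (auto simp: Z_0 Z_Suc self_adjoint_iff blinfun.bilinear_simps cinner_simps)
  have Z_lim: "(\<lambda>n. Z n x) \<longlonglongrightarrow> L x" for x
    using L by (intro tendsto_intros)
  have "L (c *\<^sub>C x) = c *\<^sub>C L x" for c x
    using Z_lim[of "c *\<^sub>C x"] bounded_linear.tendsto[OF bounded_linear_scaleC Z_lim[of x], of c]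
    by (simp add: complex_linear_scaleC lin_Z LIMSEQ_unique)
  then have lin_L: "complex_linear L" by (simp add: complex_linear_def)
  have "cinner (L x) y = cinner x (L y)" for x y
  proof (rule LIMSEQ_unique)
    show "(\<lambda>n. cinner x (Z n y)) \<longlonglongrightarrow> cinner x (L y)"
      by (rule bounded_linear.tendsto[OF bounded_linear_cinner_right Z_lim])
    have "(\<lambda>n. cnj (cinner y (Z n x))) \<longlonglongrightarrow> cnj (cinner y (L x))"
      by (intro tendsto_cnj bounded_linear.tendsto[OF bounded_linear_cinner_right Z_lim])
    moreover have "cnj (cinner y u) = cinner u y" for u
      by (rule cinner_commute[symmetric])
    ultimately     show "(\<lambda>n. cinner x (Z n y)) \<longlonglongrightarrow> cinner (L x) y"
      by (simp add: sa_Z)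
  qed
  then have "self_adjoint (id_blinfun - L)"
    using lin_L by (auto simp: self_adjoint_iff complex_linear_intros blinfun.diff_left cinner_simps)
  moreover have "(id_blinfun - L) o\<^sub>L (id_blinfun - L) = id_blinfun - K"
  proof (rule blinfun_eqI)
    fix x
    have "2 *\<^sub>R L x = K x + L (L x)"
      using arg_cong[OF L_eq, of "\<lambda>T. 2 *\<^sub>R blinfun_apply T x"]
      by (simp add: blinfun.bilinear_simps)
    then show "((id_blinfun - L) o\<^sub>L (id_blinfun - L)) x = (id_blinfun - K) x"
      by (simp add: blinfun.bilinear_simps scaleR_2 algebra_simps)
  qed
  ultimately show ?thesis using that by blast
qed

text \<open>The square root of \<open>1 - C\<^sup>* C\<close> completes a contraction \<open>C\<close> to an isometric column.\<close>
lemma ex_contraction_defect: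
  assumes C: "complex_linear C" "norm C \<le> 1"
  obtains Y where "complex_linear Y" "(cadjoint C o\<^sub>L C) + (cadjoint Y o\<^sub>L Y) = id_blinfun"
proof -
  have "self_adjoint (cadjoint C o\<^sub>L C)"
    using C(1) by (auto simp: self_adjoint_iff cadjoint_simps complex_linear_intros)
  moreover have "norm (cadjoint C o\<^sub>L C) \<le> 1"
  proof -
    have "norm (cadjoint C o\<^sub>L C) \<le> norm (cadjoint C) * norm C" by (rule norm_blinfun_compose)
    also have "\<dots> \<le> 1 * 1"
      using norm_cadjoint_le[OF C(1)] C(2) by (intro mult_mono) auto
    finally show ?thesis by simp
  qed
  ultimately obtain Y where "self_adjoint Y" "Y o\<^sub>L Y = id_blinfun - (cadjoint C o\<^sub>L C)"
    by (rule ex_sqrt_id_minus)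
  then show ?thesis using that[of Y] by (simp add: self_adjoint_def)
qed

section \<open>Regular mappings along isometries\<close>

lemma cadjoint_zero_on_ocomplement:
  assumes V: "complex_linear V" and y: "y \<in> ocomplement (range (blinfun_apply V))"
  shows "cadjoint V y = 0"
proof -
  have "cinner (cadjoint V y) z = 0" for z
    using y V unfolding ocomplement_def
    by (auto simp: cinner_cadjoint_left) (metis cinner_commute complex_cnj_zero)
  then show ?thesis by (intro cinner_ext_left) simp
qed

lemma range_projection_symmetric:
  assumes "complex_linear V"
  shows "cinner (V (cadjoint V x)) y = cinner x (V (cadjoint V y))"
  by (metis assms cinner_cadjoint_left cinner_cadjoint_right)

lemma isometry_range: "isometry V \<Longrightarrow> range (blinfun_apply V) = {x. V (cadjoint V x) = x}"
  by (auto simp: isometry_cadjoint) (metis rangeI)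

lemma isometry_range_closed_csubspace:
  assumes V: "isometry V" and nontrivial: "nonzero_closed_csubspace (UNIV :: 'h::complex_hilbert set)"
  shows "nonzero_closed_csubspace (range (blinfun_apply (V :: 'h \<Rightarrow>\<^sub>L 'h)))"
proof -
  have lin: "complex_linear V" using V by (simp add: isometry_def)
  have range: "range (blinfun_apply V) = {x. (V o\<^sub>L cadjoint V) x = id_blinfun x}"
    using isometry_range[OF V] by simp
  obtain x :: 'h where "x \<noteq> 0"
    using nontrivial unfolding nonzero_closed_csubspace_def by blast
  then have "V x \<noteq> 0"
    using isometry_cadjoint[OF V, of x] by (metis blinfun.zero_right)
  then have "range (blinfun_apply V) \<noteq> {0}" by blast
  moreover have "complex_vector.subspace (range (blinfun_apply V))"
    unfolding range by (intro csubspace_equalizer complex_linear_intros lin)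
  moreover have "closed (range (blinfun_apply V))"
    unfolding range by (rule closed_equalizer)
  ultimately show ?thesis unfolding nonzero_closed_csubspace_def by blast
qed

lemma isometry_unitary_onto_range:
  "isometry V \<Longrightarrow> unitary_between UNIV (range (blinfun_apply V)) V"
  by (auto simp: unitary_between_def bops_def isometry_def blinfun.zero_right)

lemma pos_tuples_conjugate_range:
  assumes V: "complex_linear V" and x: "x \<in> pos_tuples UNIV"
  shows "(\<chi> i. V o\<^sub>L x $ i o\<^sub>L cadjoint V) \<in> pos_tuples (range (blinfun_apply V))"
  using assms
  by (auto simp: pos_tuples_def bops_def positive_op_conjugate complex_linear_intros
      cadjoint_zero_on_ocomplement blinfun.zero_right)

lemma pos_tuples_UNIV_compress:
  assumes "complex_linear W" "x \<in> pos_tuples UNIV"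
  shows "(\<chi> i. cadjoint W o\<^sub>L x $ i o\<^sub>L W) \<in> pos_tuples UNIV"
  using assms by (simp add: pos_tuples_UNIV positive_op_compress)

lemma pos_tuples_UNIV_add:
  "x \<in> pos_tuples UNIV \<Longrightarrow> y \<in> pos_tuples UNIV \<Longrightarrow> x + y \<in> pos_tuples UNIV"
  by (simp add: pos_tuples_UNIV positive_op_add)

lemma pos_tuples_subset_UNIV: "x \<in> pos_tuples K \<Longrightarrow> x \<in> pos_tuples UNIV"
  unfolding pos_tuples_UNIV by (simp add: pos_tuples_def)

lemma subspace_sumI: "x \<in> K \<Longrightarrow> y \<in> L \<Longrightarrow> x + y \<in> subspace_sum K L"
  unfolding subspace_sum_def by blast

text \<open>The maps on the closed subspaces witnessing regularity are fixed once, so that \<open>F\<close> can be computed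
  through them.\<close>
locale regular_family =
  fixes F :: "(('h::complex_hilbert \<Rightarrow>\<^sub>L 'h) ^ 'k::finite) \<Rightarrow> ('h \<Rightarrow>\<^sub>L 'h)"
    and FK :: "'h set \<Rightarrow> (('h \<Rightarrow>\<^sub>L 'h) ^ 'k) \<Rightarrow> ('h \<Rightarrow>\<^sub>L 'h)"
  assumes nontrivial: "nonzero_closed_csubspace (UNIV :: 'h set)"
    and FK_bops: "nonzero_closed_csubspace K \<Longrightarrow> x \<in> pos_tuples K \<Longrightarrow> FK K x \<in> bops K K"
    and FK_UNIV: "x \<in> pos_tuples UNIV \<Longrightarrow> FK UNIV x = F x"
    and FK_unitary: "nonzero_closed_csubspace K \<Longrightarrow> nonzero_closed_csubspace L \<Longrightarrow>
      unitary_between K L u \<Longrightarrow> x \<in> pos_tuples K \<Longrightarrow>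
      FK L (\<chi> i. u o\<^sub>L x $ i o\<^sub>L cadjoint u) = u o\<^sub>L FK K x o\<^sub>L cadjoint u"
    and FK_block: "nonzero_closed_csubspace K \<Longrightarrow> nonzero_closed_csubspace L \<Longrightarrow>
      corthogonal K L \<Longrightarrow> x \<in> pos_tuples K \<Longrightarrow> y \<in> pos_tuples L \<Longrightarrow>
      FK (subspace_sum K L) (x + y) = FK K x + FK L y"
begin

lemma FK_isometry:
  assumes V: "isometry V" and x: "x \<in> pos_tuples UNIV"
  shows "FK (range (blinfun_apply V)) (\<chi> i. V o\<^sub>L x $ i o\<^sub>L cadjoint V) = V o\<^sub>L F x o\<^sub>L cadjoint V"
  using FK_unitary[OF nontrivial isometry_range_closed_csubspace[OF V nontrivial]
      isometry_unitary_onto_range[OF V] x]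
  by (simp add: FK_UNIV[OF x])

lemma F_surjective_isometry:
  assumes V: "isometry V" "range (blinfun_apply V) = UNIV" and x: "x \<in> pos_tuples UNIV"
  shows "F (\<chi> i. V o\<^sub>L x $ i o\<^sub>L cadjoint V) = V o\<^sub>L F x o\<^sub>L cadjoint V"
  using FK_isometry[OF V(1) x] pos_tuples_conjugate_range[of V x] V x
  by (simp add: FK_UNIV isometry_def)

text \<open>The block diagonal rule for \<open>A \<oplus> B\<close>, with the direct sum of two copies of the space modelled
  inside the space itself.\<close>
lemma F_doubling:
  assumes V: "isometry V" and W: "isometry W" and WV: "\<And>x. cadjoint V (blinfun_apply W x) = 0"
    and sum: "\<And>x. V (cadjoint V x) + W (cadjoint W x) = x"
    and A: "A \<in> pos_tuples UNIV" and B: "B \<in> pos_tuples UNIV"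
  shows "F (\<chi> i. (V o\<^sub>L A $ i o\<^sub>L cadjoint V) + (W o\<^sub>L B $ i o\<^sub>L cadjoint W)) =
    (V o\<^sub>L F A o\<^sub>L cadjoint V) + (W o\<^sub>L F B o\<^sub>L cadjoint W)"
proof -
  let ?K = "range (blinfun_apply V)" and ?L = "range (blinfun_apply W)"
  let ?x = "\<chi> i. V o\<^sub>L A $ i o\<^sub>L cadjoint V" and ?y = "\<chi> i. W o\<^sub>L B $ i o\<^sub>L cadjoint W"
  have lin: "complex_linear V" "complex_linear W" using V W by (auto simp: isometry_def)
  have x: "?x \<in> pos_tuples ?K" and y: "?y \<in> pos_tuples ?L"
    using pos_tuples_conjugate_range lin A B by blast+
  have "corthogonal ?K ?L"
    using lin by (auto simp: corthogonal_def WV simp flip: cinner_cadjoint_right)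
  then have "FK (subspace_sum ?K ?L) (?x + ?y) = FK ?K ?x + FK ?L ?y"
    using V W nontrivial x y by (intro FK_block isometry_range_closed_csubspace)
  moreover have "subspace_sum ?K ?L = UNIV"
  proof (rule UNIV_eq_I[symmetric])
    fix z
    have "V (cadjoint V z) + W (cadjoint W z) \<in> subspace_sum ?K ?L"
      by (intro subspace_sumI rangeI)
    then show "z \<in> subspace_sum ?K ?L" by (simp only: sum)
  qed
  moreover have "?x + ?y \<in> pos_tuples UNIV"
    by (rule pos_tuples_UNIV_add[OF pos_tuples_subset_UNIV[OF x] pos_tuples_subset_UNIV[OF y]])
  moreover have "?x + ?y = (\<chi> i. (V o\<^sub>L A $ i o\<^sub>L cadjoint V) + (W o\<^sub>L B $ i o\<^sub>L cadjoint W))"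
    by (simp add: vec_eq_iff)
  ultimately show ?thesis
    by (simp add: FK_UNIV FK_isometry V W A B)
qed

text \<open>Regularity splits the image of the pinching into its parts on the range of \<open>W\<close> and on the orthogonal
  complement \<open>N\<close> of that range.  The first is carried by \<open>W\<close> from \<open>F (W\<^sup>* T W)\<close>, and \<open>W\<^sup>*\<close> annihilates
  the second.\<close>
lemma F_pinching_corner:
  assumes W: "isometry W" and T: "T \<in> pos_tuples UNIV"
  defines "P \<equiv> W o\<^sub>L cadjoint W" and "Q \<equiv> id_blinfun - (W o\<^sub>L cadjoint W)"
  shows "cadjoint W o\<^sub>L F (\<chi> i. (P o\<^sub>L T $ i o\<^sub>L P) + (Q o\<^sub>L T $ i o\<^sub>L Q)) o\<^sub>L W =
    F (\<chi> i. cadjoint W o\<^sub>L T $ i o\<^sub>L W)"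
proof -
  have lin: "complex_linear W" using W by (simp add: isometry_def)
  have linQ: "complex_linear Q" unfolding Q_def by (intro complex_linear_intros lin)
  let ?M = "range (blinfun_apply W)"
  define N where "N = {x. cadjoint W x = 0}"
  let ?C = "\<chi> i. cadjoint W o\<^sub>L T $ i o\<^sub>L W"
  let ?x = "\<chi> i. P o\<^sub>L T $ i o\<^sub>L P" and ?y = "\<chi> i. Q o\<^sub>L T $ i o\<^sub>L Q"
  have sum: "(\<chi> i. (P o\<^sub>L T $ i o\<^sub>L P) + (Q o\<^sub>L T $ i o\<^sub>L Q)) = ?x + ?y"
    by (simp add: vec_eq_iff)
  have x_eq: "?x = (\<chi> i. W o\<^sub>L ?C $ i o\<^sub>L cadjoint W)"
    by (simp add: vec_eq_iff P_def blinfun_eqI)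
  have C: "?C \<in> pos_tuples UNIV" by (rule pos_tuples_UNIV_compress[OF lin T])
  have x: "?x \<in> pos_tuples ?M" unfolding x_eq by (rule pos_tuples_conjugate_range[OF lin C])
  have FK_x: "FK ?M ?x = W o\<^sub>L F ?C o\<^sub>L cadjoint W" unfolding x_eq by (rule FK_isometry[OF W C])
  have QN: "Q z \<in> N" for z
    by (simp add: N_def Q_def blinfun.diff_left blinfun.diff_right isometry_cadjoint W)
  have N_Q: "Q z = z" if "z \<in> N" for z
    using that by (simp add: N_def Q_def blinfun.diff_left blinfun.zero_right)
  have split: "z = W (cadjoint W z) + Q z" for z
    by (simp add: Q_def blinfun.diff_left)
  have cadjQ: "cadjoint Q = Q"
    by (rule cadjoint_eqI) (simp add: Q_def blinfun.diff_left cinner_simps range_projection_symmetric lin)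
  show ?thesis
  \<comment> \<open>The block diagonal rule concerns nonzero subspaces only; for \<open>N = {0}\<close> the operator \<open>W\<close> is unitary.\<close>
  proof (cases "N = {0}")
    case True
    then have Q0: "Q z = 0" for z using QN by blast
    have "?M = UNIV" using split unfolding Q0 by (auto simp: image_iff)
    moreover have "?y = 0" by (simp add: vec_eq_iff blinfun_eqI Q0)
    ultimately have "F (?x + ?y) = W o\<^sub>L F ?C o\<^sub>L cadjoint W"
      using FK_x x FK_UNIV by simp
    then show ?thesis
      unfolding sum by (simp add: blinfun_eqI isometry_cadjoint W)
  next
    case False
    have N_alt: "N = {x. cadjoint W x = (0 :: 'h \<Rightarrow>\<^sub>L 'h) x}" by (simp add: N_def)
    have N: "nonzero_closed_csubspace N"
      using False csubspace_equalizer[of "cadjoint W" 0] closed_equalizer[of "cadjoint W" 0] lin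
      unfolding nonzero_closed_csubspace_def N_alt by (simp add: complex_linear_intros)
    have orth: "corthogonal ?M N"
      using lin by (auto simp: corthogonal_def N_def simp flip: cinner_cadjoint_right)
    have y: "?y \<in> pos_tuples N"
    proof -
      have "Q z = 0" if z: "z \<in> ocomplement N" for z
      proof -
        have "cinner (Q z) (Q z) = cinner (Q (Q z)) z"
          using cinner_cadjoint_left[OF linQ, of "Q z" z] by (simp add: cadjQ)
        also have "\<dots> = 0" using z QN by (simp add: ocomplement_def)
        finally show ?thesis by (simp add: cinner_self)
      qed
      moreover have "positive_op (Q o\<^sub>L T $ i o\<^sub>L Q)" for i
        using positive_op_compress[OF linQ, of "T $ i"] T by (simp add: cadjQ pos_tuples_UNIV)
      ultimately show ?thesis
        using QN by (auto simp: pos_tuples_def bops_def blinfun.zero_right positive_op_iff)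
    qed
    have "subspace_sum ?M N = UNIV"
    proof (rule UNIV_eq_I[symmetric])
      fix z
      have "W (cadjoint W z) + Q z \<in> subspace_sum ?M N"
        by (intro subspace_sumI rangeI QN)
      then show "z \<in> subspace_sum ?M N" by (simp only: split[symmetric])
    qed
    moreover have "?x + ?y \<in> pos_tuples UNIV"
      by (rule pos_tuples_UNIV_add[OF pos_tuples_subset_UNIV[OF x] pos_tuples_subset_UNIV[OF y]])
    ultimately have "F (?x + ?y) = FK ?M ?x + FK N ?y"
      using FK_block[OF isometry_range_closed_csubspace[OF W nontrivial] N orth x y]
      by (simp add: FK_UNIV)
    moreover have "cadjoint W (FK N ?y z) = 0" for z
      using FK_bops[OF N y] by (simp add: bops_def N_def)
    ultimately show ?thesis
      unfolding sum FK_x by (simp add: blinfun_eqI isometry_cadjoint W blinfun.add_left blinfun.add_right)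
  qed
qed

text \<open>The pinching is the average of \<open>T\<close> and its conjugate by the reflection \<open>S\<close>, so this is convexity at
  \<open>1/2\<close>, compressed by \<open>W\<close>.\<close>
lemma F_isometric_compression:
  assumes conv: "convex_mapping F" and W: "isometry W" and T: "T \<in> pos_tuples UNIV"
  shows "F (\<chi> i. cadjoint W o\<^sub>L T $ i o\<^sub>L W) \<le>\<^sub>o\<^sub>p cadjoint W o\<^sub>L F T o\<^sub>L W"
proof -
  have lin: "complex_linear W" using W by (simp add: isometry_def)
  define P Q S where "P = W o\<^sub>L cadjoint W" and "Q = id_blinfun - (W o\<^sub>L cadjoint W)"
    and "S = P - Q"
  have S_app: "S z = 2 *\<^sub>R W (cadjoint W z) - z" for z
    by (simp add: S_def P_def Q_def blinfun.diff_left scaleR_2)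
  have SW: "S (W z) = W z" for z
    by (simp add: S_app isometry_cadjoint W scaleR_2)
  have WS: "cadjoint W (S z) = cadjoint W z" for z
    by (simp add: S_app isometry_cadjoint W scaleR_2 blinfun.diff_right blinfun.add_right)
  have linS: "complex_linear S"
    unfolding S_def P_def Q_def by (intro complex_linear_intros lin)
  have cadjS: "cadjoint S = S"
    by (rule cadjoint_eqI) (simp add: S_app cinner_simps range_projection_symmetric lin)
  have SS: "S (S z) = z" for z
    by (subst S_app) (simp add: WS, simp add: S_app)
  have S: "isometry S"
    by (rule isometryI_cadjoint[OF linS]) (simp add: cadjS SS)
  have rangeS: "range (blinfun_apply S) = UNIV"
    using SS by (metis surjI)
  let ?ST = "\<chi> i. S o\<^sub>L T $ i o\<^sub>L cadjoint S"
  have ST: "?ST \<in> pos_tuples UNIV"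
    using pos_tuples_conjugate_range[OF linS T] by (simp add: rangeS)
  let ?G = "F (\<chi> i. (P o\<^sub>L T $ i o\<^sub>L P) + (Q o\<^sub>L T $ i o\<^sub>L Q))"
  have average: "(1/2) *\<^sub>R T + (1 - 1/2) *\<^sub>R ?ST = (\<chi> i. (P o\<^sub>L T $ i o\<^sub>L P) + (Q o\<^sub>L T $ i o\<^sub>L Q))"
  proof -
    have "(1/2) *\<^sub>R (t z) + (1/2) *\<^sub>R S (t (S z)) = P (t (P z)) + Q (t (Q z))"
      for t :: "'h \<Rightarrow>\<^sub>L 'h" and z
    proof -
      have "t z + S (t (S z)) = 2 *\<^sub>R (P (t (P z)) + Q (t (Q z)))"
        unfolding S_app by (simp add: P_def Q_def blinfun.bilinear_simps scaleR_2)
      then show ?thesis by (simp flip: scaleR_right_distrib)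
    qed
    then show ?thesis
      by (simp add: vec_eq_iff blinfun_eqI blinfun.bilinear_simps cadjS)
  qed
  have "F ((1/2) *\<^sub>R T + (1 - 1/2) *\<^sub>R ?ST) \<le>\<^sub>o\<^sub>p (1/2) *\<^sub>R F T + (1 - 1/2) *\<^sub>R F ?ST"
    by (rule conv[unfolded convex_mapping_def, rule_format, OF T ST]) simp
  then have "positive_op ((1/2) *\<^sub>R F T + (1/2) *\<^sub>R (S o\<^sub>L F T o\<^sub>L S) - ?G)"
    unfolding average loewner_le_def F_surjective_isometry[OF S rangeS T] by (simp add: cadjS)
  then have "positive_op (cadjoint W o\<^sub>L ((1/2) *\<^sub>R F T + (1/2) *\<^sub>R (S o\<^sub>L F T o\<^sub>L S) - ?G) o\<^sub>L W)"
    by (rule positive_op_compress[OF lin])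
  also have "cadjoint W o\<^sub>L ((1/2) *\<^sub>R F T + (1/2) *\<^sub>R (S o\<^sub>L F T o\<^sub>L S) - ?G) o\<^sub>L W =
      (cadjoint W o\<^sub>L F T o\<^sub>L W) - (cadjoint W o\<^sub>L ?G o\<^sub>L W)"
    by (rule blinfun_eqI) (simp add: blinfun.bilinear_simps SW WS flip: scaleR_left_distrib)
  also have "cadjoint W o\<^sub>L ?G o\<^sub>L W = F (\<chi> i. cadjoint W o\<^sub>L T $ i o\<^sub>L W)"
    unfolding P_def Q_def by (rule F_pinching_corner[OF W T])
  finally show ?thesis unfolding loewner_le_def .
qed

text \<open>The column \<open>(X, Y)\<close> is an isometry into the direct sum of two copies of the space; \<open>W\<close> is this column
  after identifying the direct sum with the space, and it compresses \<open>A \<oplus> B\<close> to \<open>X\<^sup>* A X + Y\<^sup>* B Y\<close>.\<close>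
lemma F_column_compression:
  assumes "infinite_dimensional TYPE('h)" "convex_mapping F"
    and X: "complex_linear X" and Y: "complex_linear Y"
    and XY: "(cadjoint X o\<^sub>L X) + (cadjoint Y o\<^sub>L Y) = id_blinfun"
    and A: "A \<in> pos_tuples UNIV" and B: "B \<in> pos_tuples UNIV"
  shows "F (\<chi> i. (cadjoint X o\<^sub>L A $ i o\<^sub>L X) + (cadjoint Y o\<^sub>L B $ i o\<^sub>L Y))
    \<le>\<^sub>o\<^sub>p (cadjoint X o\<^sub>L F A o\<^sub>L X) + (cadjoint Y o\<^sub>L F B o\<^sub>L Y)"
proof -
  obtain U V :: "'h \<Rightarrow>\<^sub>L 'h" where U: "isometry U" and V: "isometry V"
    and UV: "\<And>x. cadjoint U (V x) = 0" "\<And>x. cadjoint V (U x) = 0"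
    and sum: "\<And>x. U (cadjoint U x) + V (cadjoint V x) = x"
    using ex_doubling[OF assms(1)] by metis
  have lin: "complex_linear U" "complex_linear V" using U V by (auto simp: isometry_def)
  define W where "W = (U o\<^sub>L X) + (V o\<^sub>L Y)"
  have linW: "complex_linear W" unfolding W_def by (intro complex_linear_intros lin X Y)
  have cadjW: "cadjoint W = (cadjoint X o\<^sub>L cadjoint U) + (cadjoint Y o\<^sub>L cadjoint V)"
    by (rule cadjoint_eqI)
      (simp add: W_def blinfun.add_left cinner_simps cadjoint_simps lin X Y complex_linear_cadjoint)
  have UW: "cadjoint U (W x) = X x" and VW: "cadjoint V (W x) = Y x" for x
    by (simp_all add: W_def blinfun.add_left blinfun.add_right isometry_cadjoint U V UV)
  have W: "isometry W"
  proof (rule isometryI_cadjoint[OF linW])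
    fix x
    have "cadjoint W (W x) = ((cadjoint X o\<^sub>L X) + (cadjoint Y o\<^sub>L Y)) x"
      by (simp add: cadjW blinfun.add_left UW VW)
    then show "cadjoint W (W x) = x" by (simp add: XY)
  qed
  let ?T = "\<chi> i. (U o\<^sub>L A $ i o\<^sub>L cadjoint U) + (V o\<^sub>L B $ i o\<^sub>L cadjoint V)"
  have compress: "cadjoint W o\<^sub>L ((U o\<^sub>L a o\<^sub>L cadjoint U) + (V o\<^sub>L b o\<^sub>L cadjoint V)) o\<^sub>L W =
      (cadjoint X o\<^sub>L a o\<^sub>L X) + (cadjoint Y o\<^sub>L b o\<^sub>L Y)" for a b
    by (rule blinfun_eqI)
      (simp add: cadjW blinfun.add_left blinfun.add_right UW VW isometry_cadjoint U V UV blinfun.zero_right)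
  have T: "?T \<in> pos_tuples UNIV"
    using A B lin by (simp add: pos_tuples_UNIV positive_op_add positive_op_conjugate)
  from F_isometric_compression[OF assms(2) W T] show ?thesis
    by (simp add: compress F_doubling[OF U V UV(1) sum A B])
qed

end

lemma regular_mapping_family:
  fixes F :: "(('h::complex_hilbert \<Rightarrow>\<^sub>L 'h) ^ 'k::finite) \<Rightarrow> ('h \<Rightarrow>\<^sub>L 'h)"
  assumes inf: "infinite_dimensional TYPE('h)" and reg: "regular_mapping F"
  obtains FK where "regular_family F FK"
proof -
  have "UNIV \<noteq> {0 :: 'h}"
    using inf unfolding infinite_dimensional_def
    by (metis complex_vector.span_empty finite.emptyI)
  then have "nonzero_closed_csubspace (UNIV :: 'h set)"
    by (simp add: nonzero_closed_csubspace_def)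
  moreover obtain FK where
    "\<forall>K. nonzero_closed_csubspace K \<longrightarrow> (\<forall>x\<in>pos_tuples K. FK K x \<in> bops K K)"
    "\<forall>x\<in>pos_tuples UNIV. FK UNIV x = F x"
    "\<forall>K L u x. nonzero_closed_csubspace K \<and> nonzero_closed_csubspace L \<and>
       unitary_between K L u \<and> x \<in> pos_tuples K \<longrightarrow>
       FK L (\<chi> i. u o\<^sub>L x $ i o\<^sub>L cadjoint u) = u o\<^sub>L FK K x o\<^sub>L cadjoint u"
    "\<forall>K L x y. nonzero_closed_csubspace K \<and> nonzero_closed_csubspace L \<and>
       corthogonal K L \<and> x \<in> pos_tuples K \<and> y \<in> pos_tuples L \<longrightarrow>
       FK (subspace_sum K L) (x + y) = FK K x + FK L y"
    using reg unfolding regular_mapping_def by (elim exE conjE)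
  ultimately have "regular_family F FK"
    by unfold_locales simp_all
  then show ?thesis by (rule that)
qed

theorem theorem2p2:
  fixes F :: "(('h::complex_hilbert \<Rightarrow>\<^sub>L 'h) ^ 'k::finite) \<Rightarrow> ('h \<Rightarrow>\<^sub>L 'h)"
  assumes "infinite_dimensional TYPE('h)"
    and "\<And>A. A \<in> pos_tuples UNIV \<Longrightarrow> self_adjoint (F A)"
    and "convex_mapping F"
    and "regular_mapping F"
  shows "(\<forall>C \<in> bops UNIV UNIV. norm C \<le> 1 \<longrightarrow> F 0 \<le>\<^sub>o\<^sub>p 0 \<longrightarrow>
            (\<forall>A \<in> pos_tuples UNIV.
               F (\<chi> i. cadjoint C o\<^sub>L A $ i o\<^sub>L C) \<le>\<^sub>o\<^sub>p cadjoint C o\<^sub>L F A o\<^sub>L C)) \<and>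
         (\<forall>X \<in> bops UNIV UNIV. \<forall>Y \<in> bops UNIV UNIV.
            (cadjoint X o\<^sub>L X) + (cadjoint Y o\<^sub>L Y) = id_blinfun \<longrightarrow>
            (\<forall>A \<in> pos_tuples UNIV. \<forall>B \<in> pos_tuples UNIV.
               F (\<chi> i. (cadjoint X o\<^sub>L A $ i o\<^sub>L X) + (cadjoint Y o\<^sub>L B $ i o\<^sub>L Y))
                 \<le>\<^sub>o\<^sub>p (cadjoint X o\<^sub>L F A o\<^sub>L X) + (cadjoint Y o\<^sub>L F B o\<^sub>L Y)))"
proof -
  obtain FK where "regular_family F FK"
    using regular_mapping_family[OF assms(1,4)] .
  then interpret regular_family F FK .
  note column = F_column_compression[OF assms(1,3)]
  have "F (\<chi> i. cadjoint C o\<^sub>L A $ i o\<^sub>L C) \<le>\<^sub>o\<^sub>p cadjoint C o\<^sub>L F A o\<^sub>L C"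
    if C: "complex_linear C" "norm C \<le> 1" and F0: "F 0 \<le>\<^sub>o\<^sub>p 0" and A: "A \<in> pos_tuples UNIV" for C A
  proof -
    obtain Y where Y: "complex_linear Y" "(cadjoint C o\<^sub>L C) + (cadjoint Y o\<^sub>L Y) = id_blinfun"
      using ex_contraction_defect[OF C] .
    \<comment> \<open>The zero tuple serves as \<open>B\<close>; its contribution \<open>Y\<^sup>* F(0) Y\<close> is then discarded.\<close>
    have "0 \<in> (pos_tuples UNIV :: (('h \<Rightarrow>\<^sub>L 'h) ^ 'k) set)"
      by (simp add: pos_tuples_UNIV positive_op_zero)
    from column[OF C(1) Y A this]
    have "positive_op ((cadjoint C o\<^sub>L F A o\<^sub>L C) + (cadjoint Y o\<^sub>L F 0 o\<^sub>L Y)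
        - F (\<chi> i. cadjoint C o\<^sub>L A $ i o\<^sub>L C))"
      by (simp add: loewner_le_def)
    moreover have "positive_op (cadjoint Y o\<^sub>L (0 - F 0) o\<^sub>L Y)"
      using F0 Y(1) by (intro positive_op_compress) (simp_all add: loewner_le_def)
    ultimately have "positive_op ((cadjoint C o\<^sub>L F A o\<^sub>L C) + (cadjoint Y o\<^sub>L F 0 o\<^sub>L Y)
        - F (\<chi> i. cadjoint C o\<^sub>L A $ i o\<^sub>L C) + (cadjoint Y o\<^sub>L (0 - F 0) o\<^sub>L Y))"
      by (rule positive_op_add)
    also have "(cadjoint C o\<^sub>L F A o\<^sub>L C) + (cadjoint Y o\<^sub>L F 0 o\<^sub>L Y)
        - F (\<chi> i. cadjoint C o\<^sub>L A $ i o\<^sub>L C) + (cadjoint Y o\<^sub>L (0 - F 0) o\<^sub>L Y)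
      = (cadjoint C o\<^sub>L F A o\<^sub>L C) - F (\<chi> i. cadjoint C o\<^sub>L A $ i o\<^sub>L C)"
      by (rule blinfun_eqI) (simp add: blinfun.bilinear_simps)
    finally show ?thesis by (simp add: loewner_le_def)
  qed
  then show ?thesis
    using column by (simp add: bops_UNIV)
qed

end
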